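(* Let $1\leq p<\infty$ and $n\geq 2$. The space $\mathcal{B}^{p}(\mathbb{R}^{n})$ is properly contained in $B^{p}(\mathbb{R}^{n})$, i.e. $\mathcal{B}^{p}(\mathbb{R}^{n})\subsetneq B^{p}(\mathbb{R}^{n})$.
   Context: Functions are Lebesgue measurable real-valued functions on $\mathbb{R}^n$, and functions equal almost everywhere are identified. For $1\leq p<\infty$: (1) $B^{p}(\mathbb{R}^{n})$ is the space of measurable $f$ with $$\|f\|_{B^p}:=\sup_{R\geq 1}\left(\frac{1}{|B_R(0)|}\int_{B_R(0)}|f(x)|^p\,dx\right)^{1/p}<\infty,$$ where $B_R(0)$ is the open Euclidean ball of radius $R$ centered at $0$ and $|\cdot|$ denotes Lebesgue measure. (2) $\mathcal{B}^{p}(\mathbb{R}^{n})$ (the rectangular Herz space) is the space of $f\in L^p_{loc}(\mathbb{R}^n)$ with $$\|f\|_{\mathcal{B}^{p}}:=\sup_{R_j\geq 1,\ j=1,\dots,n}\left[\frac{1}{R_1\cdots R_n}\int_{[-R_1,R_1]\times\cdots\times[-R_n,R_n]}|f(x)|^p\,dx\right]^{1/p}<\infty,$$ the supremum being over all $(R_1,\dots,R_n)$ with every $R_j\geq 1$. *)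

theory Defs
  imports "HOL-Analysis.Analysis"
begin

(* Extension of real powers to [0, \<infinity>], for positive exponents only:
   \<infinity> powr a = \<infinity>. *)
definition ennreal_powr :: "ennreal \<Rightarrow> real \<Rightarrow> ennreal" where
  "ennreal_powr x a = (if x = \<infinity> then \<infinity> else ennreal (enn2real x powr a))"

definition ae_eq :: "((real^'n \<Rightarrow> real) \<times> (real^'n \<Rightarrow> real)) set" where
  "ae_eq = {(f, g). f \<in> borel_measurable lebesgue \<and> g \<in> borel_measurable lebesgue \<and>
                    (AE x in lebesgue. f x = g x)}"

lemma equiv_ae_eq: "equiv (borel_measurable lebesgue) ae_eq"
proof (rule equivI)
  show "trans ae_eq"
  proof (rule transI)
    fix f g h :: "real^'n \<Rightarrow> real"
    assume fg: "(f, g) \<in> ae_eq" and gh: "(g, h) \<in> ae_eq"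
    then have "AE x in lebesgue. f x = g x" "AE x in lebesgue. g x = h x"
      by (auto simp: ae_eq_def)
    then have "AE x in lebesgue. f x = h x"
      by eventually_elim simp
    with fg gh show "(f, h) \<in> ae_eq"
      by (auto simp: ae_eq_def)
  qed
qed (auto simp: ae_eq_def refl_on_def sym_def eq_commute)

(* The norms take values in [0, \<infinity>], so that finiteness is a genuine condition. *)
definition Bp_norm :: "real \<Rightarrow> (real^'n \<Rightarrow> real) \<Rightarrow> ennreal" where
  "Bp_norm p f =
    (SUP R\<in>{1..}. ennreal_powr
      ((\<integral>\<^sup>+x\<in>ball 0 R. ennreal (\<bar>f x\<bar> powr p) \<partial>lebesgue)
        / emeasure lebesgue (ball (0 :: real^'n) R)) (1 / p))"

definition rect_Bp_norm :: "real \<Rightarrow> (real^'n \<Rightarrow> real) \<Rightarrow> ennreal" where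
  "rect_Bp_norm p f =
    (SUP R\<in>{R :: real^'n. \<forall>j. 1 \<le> R $ j}. ennreal_powr
      ((\<integral>\<^sup>+x\<in>cbox (- R) R. ennreal (\<bar>f x\<bar> powr p) \<partial>lebesgue)
        / ennreal (\<Prod>j\<in>UNIV. R $ j)) (1 / p))"

definition Lp_loc :: "real \<Rightarrow> (real^'n \<Rightarrow> real) set" where
  "Lp_loc p = {f \<in> borel_measurable lebesgue.
    \<forall>K. compact K \<longrightarrow> (\<integral>\<^sup>+x\<in>K. ennreal (\<bar>f x\<bar> powr p) \<partial>lebesgue) < \<infinity>}"

(* Elements of both spaces are classes of functions modulo equality almost everywhere. *)
definition Bp_space :: "real \<Rightarrow> (real^'n \<Rightarrow> real) set set" where
  "Bp_space p = {f \<in> borel_measurable lebesgue. Bp_norm p f < \<infinity>} // ae_eq"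

definition rect_Bp_space :: "real \<Rightarrow> (real^'n \<Rightarrow> real) set set" where
  "rect_Bp_space p = {f \<in> Lp_loc p. rect_Bp_norm p f < \<infinity>} // ae_eq"

end

theory Submission
  imports Defs
begin

text \<open>Since \<open>x \<mapsto> x powr (1 / p)\<close> is increasing, finiteness of either norm is a growth
  condition on the integrals of \<open>\<bar>f\<bar> powr p\<close>: over the balls of radius \<open>R \<ge> 1\<close> they must be
  \<open>O(R ^ n)\<close>, over the boxes with half side lengths \<open>R\<^sub>j \<ge> 1\<close> they must be \<open>O(\<Prod>j. R\<^sub>j)\<close>
  (\<open>Bp_norm_finite_iff\<close>, \<open>rect_Bp_norm_finite_iff\<close>). The second condition implies the first because
  the ball of radius \<open>R\<close> lies in the cube of half side length \<open>R\<close>.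

  The inclusion is proper because balls cannot detect concentration along a coordinate
  axis, whereas long thin boxes can. Let \<open>\<bar>f x\<bar> powr p\<close> be \<open>\<bar>x\<^sub>k\<bar>\<close> on the tube of width 2
  around the \<open>k\<close>-th axis, and 0 elsewhere. The part of the tube in the ball of radius \<open>R\<close> has
  volume \<open>O(R)\<close> and \<open>\<bar>f\<bar> powr p\<close> is at most \<open>R\<close> there, so the integral over the ball is
  \<open>O(R\<^sup>2)\<close>, which is \<open>O(R ^ n)\<close> as \<open>n \<ge> 2\<close>. But the integral over the box of half side lengths
  \<open>R\<close> along the axis and 1 across it is at least \<open>R\<^sup>2 / 4\<close>, which is not \<open>O(R)\<close>.\<close>

section \<open>The norms as growth conditions\<close>

text \<open>A supremum in \<open>[0, \<infinity>]\<close> is finite exactly when the family has a finite bound, and bounds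
  for the family and for its powers are converted into each other by \<open>powr a\<close> and
  \<open>powr (1 / a)\<close>. This removes the exponent \<open>1 / p\<close> from both norms.\<close>

lemma SUP_ennreal_powr_finite_iff:
  fixes F :: "'a \<Rightarrow> ennreal"
  assumes "a > 0"
  shows "(SUP i\<in>A. ennreal_powr (F i) a) < \<infinity> \<longleftrightarrow> (\<exists>C\<ge>0. \<forall>i\<in>A. F i \<le> ennreal C)"
proof
  assume fin: "(SUP i\<in>A. ennreal_powr (F i) a) < \<infinity>"
  define M where "M = enn2real (SUP i\<in>A. ennreal_powr (F i) a)"
  have M: "ennreal M = (SUP i\<in>A. ennreal_powr (F i) a)"
    using fin by (simp add: M_def)
  have "F i \<le> ennreal (M powr (1 / a))" if "i \<in> A" for i
  proof -
    have le: "ennreal_powr (F i) a \<le> ennreal M"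
      unfolding M using that by (rule SUP_upper)
    then have top: "F i \<noteq> \<infinity>"
      by (auto simp: ennreal_powr_def top_unique)
    with le have "enn2real (F i) powr a \<le> M"
      by (simp add: ennreal_powr_def M_def)
    then have "(enn2real (F i) powr a) powr (1 / a) \<le> M powr (1 / a)"
      using assms by (intro powr_mono2) auto
    then have "enn2real (F i) \<le> M powr (1 / a)"
      using assms by (simp add: powr_powr)
    then show ?thesis
      using top by (metis ennreal_enn2real ennreal_leI infinity_ennreal_def less_top)
  qed
  then show "\<exists>C\<ge>0. \<forall>i\<in>A. F i \<le> ennreal C"
    by (intro exI[of _ "M powr (1 / a)"]) auto
next
  assume "\<exists>C\<ge>0. \<forall>i\<in>A. F i \<le> ennreal C"
  then obtain C where C: "C \<ge> 0" "\<And>i. i \<in> A \<Longrightarrow> F i \<le> ennreal C"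
    by blast
  have "ennreal_powr (F i) a \<le> ennreal (C powr a)" if "i \<in> A" for i
  proof -
    have "F i \<noteq> \<infinity>"
      using C(2)[OF that] by (auto simp: top_unique)
    moreover have "enn2real (F i) \<le> C"
      using C that by (simp add: enn2real_leI)
    ultimately show ?thesis
      using assms by (auto simp: ennreal_powr_def intro!: ennreal_leI powr_mono2)
  qed
  then have "(SUP i\<in>A. ennreal_powr (F i) a) \<le> ennreal (C powr a)"
    by (intro SUP_least)
  then show "(SUP i\<in>A. ennreal_powr (F i) a) < \<infinity>"
    using ennreal_less_top le_less_trans by (metis infinity_ennreal_def)
qed

lemma divide_ennreal_le_iff:
  fixes x :: ennreal
  assumes "v > 0" "C \<ge> 0"
  shows "x / ennreal v \<le> ennreal C \<longleftrightarrow> x \<le> ennreal (C * v)"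
proof (cases x)
  case (real r)
  then show ?thesis
    using assms by (simp add: divide_ennreal pos_divide_le_eq)
next
  case top
  then show ?thesis
    using assms by (simp add: ennreal_top_divide top_unique)
qed

lemma rect_Bp_norm_finite_iff:
  fixes f :: "real^'n \<Rightarrow> real"
  assumes "p > 0"
  shows "rect_Bp_norm p f < \<infinity> \<longleftrightarrow>
    (\<exists>C\<ge>0. \<forall>R. (\<forall>j. 1 \<le> R $ j) \<longrightarrow>
      (\<integral>\<^sup>+x\<in>cbox (- R) R. ennreal (\<bar>f x\<bar> powr p) \<partial>lebesgue)
        \<le> ennreal (C * (\<Prod>j\<in>UNIV. R $ j)))"
proof -
  have pos: "(\<Prod>j\<in>UNIV. R $ j) > 0" if "\<forall>j. 1 \<le> R $ j" for R :: "real^'n"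
    using that by (intro prod_pos) (auto intro: less_le_trans[OF zero_less_one])
  have "rect_Bp_norm p f < \<infinity> \<longleftrightarrow>
    (\<exists>C\<ge>0. \<forall>R\<in>{R. \<forall>j. 1 \<le> R $ j}.
      (\<integral>\<^sup>+x\<in>cbox (- R) R. ennreal (\<bar>f x\<bar> powr p) \<partial>lebesgue)
        / ennreal (\<Prod>j\<in>UNIV. R $ j) \<le> ennreal C)"
    unfolding rect_Bp_norm_def using assms by (intro SUP_ennreal_powr_finite_iff) simp
  then show ?thesis
    using pos by (simp add: divide_ennreal_le_iff cong: conj_cong imp_cong)
qed

text \<open>The volume of the unit ball is absorbed into the constant.\<close>

text \<open>The ball of radius \<open>R\<close> lies in the cube of half side length \<open>R\<close>, for which the product of
  the half side lengths is \<open>R ^ n\<close>.\<close>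

lemma Bp_norm_finite_iff:
  fixes f :: "real^'n \<Rightarrow> real"
  assumes "p > 0"
  shows "Bp_norm p f < \<infinity> \<longleftrightarrow>
    (\<exists>C\<ge>0. \<forall>R\<ge>1. (\<integral>\<^sup>+x\<in>ball 0 R. ennreal (\<bar>f x\<bar> powr p) \<partial>lebesgue)
      \<le> ennreal (C * R ^ CARD('n)))"
    (is "_ \<longleftrightarrow> (\<exists>C\<ge>0. \<forall>R\<ge>1. ?I R \<le> ennreal (C * R ^ ?n))")
proof -
  define u where "u = unit_ball_vol (real ?n)"
  have u: "u > 0"
    by (simp add: u_def)
  have ball: "emeasure lborel (ball (0 :: real^'n) R) = ennreal (u * R ^ ?n)" if "R \<ge> 1" for R
    using that by (simp add: u_def emeasure_ball)
  have "Bp_norm p f < \<infinity> \<longleftrightarrow>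
    (\<exists>C\<ge>0. \<forall>R\<in>{1..}. ?I R / emeasure lebesgue (ball (0 :: real^'n) R) \<le> ennreal C)"
    unfolding Bp_norm_def using assms by (intro SUP_ennreal_powr_finite_iff) simp
  also have "\<dots> \<longleftrightarrow> (\<exists>C\<ge>0. \<forall>R\<ge>1. ?I R \<le> ennreal (C * (u * R ^ ?n)))"
    using u by (simp add: ball divide_ennreal_le_iff Ball_def cong: conj_cong imp_cong)
  also have "\<dots> \<longleftrightarrow> (\<exists>C\<ge>0. \<forall>R\<ge>1. ?I R \<le> ennreal (C * R ^ ?n))"
  proof safe
    fix C :: real assume "C \<ge> 0" "\<forall>R\<ge>1. ?I R \<le> ennreal (C * (u * R ^ ?n))"
    then show "\<exists>C\<ge>0. \<forall>R\<ge>1. ?I R \<le> ennreal (C * R ^ ?n)"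
      using u by (intro exI[of _ "C * u"]) (simp add: mult.assoc)
  next
    fix C :: real assume "C \<ge> 0" "\<forall>R\<ge>1. ?I R \<le> ennreal (C * R ^ ?n)"
    then show "\<exists>C\<ge>0. \<forall>R\<ge>1. ?I R \<le> ennreal (C * (u * R ^ ?n))"
      using u by (intro exI[of _ "C / u"]) simp
  qed
  finally show ?thesis .
qed

section \<open>The inclusion\<close>

text \<open>The ball of radius \<open>R\<close> lies in the cube of half side length \<open>R\<close>, for which the product of
  the half side lengths is \<open>R ^ n\<close>.\<close>

lemma Bp_norm_finite_if_rect_Bp_norm_finite:
  fixes f :: "real^'n \<Rightarrow> real"
  assumes "p > 0" "rect_Bp_norm p f < \<infinity>"
  shows "Bp_norm p f < \<infinity>"
proof -
  obtain C where C: "C \<ge> 0" "\<And>R. (\<forall>j. 1 \<le> R $ j) \<Longrightarrow>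
      (\<integral>\<^sup>+x\<in>cbox (- R) R. ennreal (\<bar>f x\<bar> powr p) \<partial>lebesgue) \<le> ennreal (C * (\<Prod>j\<in>UNIV. R $ j))"
    using assms(2) unfolding rect_Bp_norm_finite_iff[OF assms(1)] by blast
  have "(\<integral>\<^sup>+x\<in>ball 0 R. ennreal (\<bar>f x\<bar> powr p) \<partial>lebesgue) \<le> ennreal (C * R ^ CARD('n))"
    if R: "R \<ge> 1" for R
  proof -
    define r :: "real^'n" where "r = (\<chi> j. R)"
    have "ball 0 R \<subseteq> cbox (- r) r"
    proof
      fix x :: "real^'n" assume "x \<in> ball 0 R"
      then have "\<bar>x $ j\<bar> \<le> R" for j
        using component_le_norm_cart[of x j] by simp
      then show "x \<in> cbox (- r) r"
        by (simp add: r_def mem_box_cart abs_le_iff minus_le_iff)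
    qed
    then have "(\<integral>\<^sup>+x\<in>ball 0 R. ennreal (\<bar>f x\<bar> powr p) \<partial>lebesgue)
        \<le> (\<integral>\<^sup>+x\<in>cbox (- r) r. ennreal (\<bar>f x\<bar> powr p) \<partial>lebesgue)"
      by (intro nn_integral_mono) (auto split: split_indicator)
    also have "\<dots> \<le> ennreal (C * R ^ CARD('n))"
      using C(2)[of r] R by (simp add: r_def)
    finally show ?thesis .
  qed
  with C(1) show ?thesis
    unfolding Bp_norm_finite_iff[OF assms(1)] by blast
qed

lemma rect_Bp_space_subset_Bp_space:
  assumes "p > 0"
  shows "(rect_Bp_space p :: (real^'n \<Rightarrow> real) set set) \<subseteq> Bp_space p"
  using assms Bp_norm_finite_if_rect_Bp_norm_finite
  unfolding rect_Bp_space_def Bp_space_def quotient_def Lp_loc_def by blast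

text \<open>To keep a class out of the rectangular space one has to exclude all of its representatives;
  by the following lemma it is enough to look at one of them.\<close>

lemma rect_Bp_norm_cong_AE:
  assumes "AE x in lebesgue. f x = g x"
  shows "rect_Bp_norm p f = rect_Bp_norm p g"
proof -
  have "(\<integral>\<^sup>+x\<in>S. ennreal (\<bar>f x\<bar> powr p) \<partial>lebesgue) = (\<integral>\<^sup>+x\<in>S. ennreal (\<bar>g x\<bar> powr p) \<partial>lebesgue)" for S
    using assms by (intro nn_integral_cong_AE) auto
  then show ?thesis
    by (simp add: rect_Bp_norm_def)
qed

section \<open>A function concentrated along a coordinate axis\<close>

definition axis_tube :: "'n \<Rightarrow> (real^'n) set" where
  "axis_tube k = {x. \<forall>j. j \<noteq> k \<longrightarrow> \<bar>x $ j\<bar> \<le> 1}"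

text \<open>The exponent \<open>1 / p\<close> makes \<open>\<bar>f\<bar> powr p\<close> grow linearly along the axis, for every \<open>p\<close>.\<close>

definition axis_fun :: "real \<Rightarrow> 'n \<Rightarrow> real^'n \<Rightarrow> real" where
  "axis_fun p k x = indicator (axis_tube k) x * \<bar>x $ k\<bar> powr (1 / p)"

definition axis_vec :: "'n \<Rightarrow> real \<Rightarrow> real \<Rightarrow> real^'n" where
  "axis_vec k s t = (\<chi> j. if j = k then s else t)"

lemma axis_fun_powr:
  assumes "p > 0"
  shows "\<bar>axis_fun p k x\<bar> powr p = indicator (axis_tube k) x * \<bar>x $ k\<bar>"
  using assms by (auto simp: axis_fun_def powr_powr split: split_indicator)

lemma borel_measurable_axis_fun: "axis_fun p k \<in> borel_measurable lebesgue"
proof -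
  have "closed (axis_tube k)"
    unfolding axis_tube_def
    by (intro closed_Collect_all closed_Collect_imp closed_Collect_le open_Collect_const
        continuous_intros)
  then have [measurable]: "axis_tube k \<in> sets borel"
    by (rule borel_closed)
  have [measurable]: "(\<lambda>x :: real^'n. x $ k) \<in> borel_measurable borel" for k
    by (intro borel_measurable_continuous_onI continuous_intros)
  have "axis_fun p k \<in> borel_measurable lborel"
    unfolding axis_fun_def by measurable
  then show ?thesis
    by (rule measurable_completion)
qed

lemma prod_axis_vec: "(\<Prod>j\<in>UNIV. axis_vec k s t $ j) = s * t ^ (CARD('n) - 1)"
  for k :: "'n::finite"
proof -
  have "(\<Prod>j\<in>UNIV. axis_vec k s t $ j) = (\<Prod>j\<in>insert k (UNIV - {k}). axis_vec k s t $ j)"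
    by (simp add: insert_absorb)
  also have "\<dots> = s * t ^ (CARD('n) - 1)"
    by (subst prod.insert) (simp_all add: axis_vec_def card_Diff_singleton)
  finally show ?thesis .
qed

lemma emeasure_cbox_axis_vec:
  fixes k :: "'n::finite"
  assumes "s \<le> s'" "t \<le> t'"
  shows "emeasure lborel (cbox (axis_vec k s t) (axis_vec k s' t'))
    = ennreal ((s' - s) * (t' - t) ^ (CARD('n) - 1))"
proof -
  have ne: "cbox (axis_vec k s t) (axis_vec k s' t') \<noteq> {}"
    using assms by (simp add: interval_ne_empty_cart axis_vec_def)
  have "axis_vec k s' t' $ j - axis_vec k s t $ j = axis_vec k (s' - s) (t' - t) $ j" for j
    by (simp add: axis_vec_def)
  then have "measure lborel (cbox (axis_vec k s t) (axis_vec k s' t'))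
      = (s' - s) * (t' - t) ^ (CARD('n) - 1)"
    by (simp add: content_cbox_cart[OF ne] prod_axis_vec)
  moreover have "emeasure lborel (cbox (axis_vec k s t) (axis_vec k s' t')) \<noteq> top"
    using emeasure_lborel_cbox_finite by (metis infinity_ennreal_def less_irrefl)
  ultimately show ?thesis
    by (metis emeasure_eq_ennreal_measure)
qed

text \<open>The integral over the ball grows like \<open>R\<^sup>2\<close> in every dimension: one factor comes from the
  size of the integrand and one from the length of the tube inside the ball. Dimension at least
  2 is what turns this into the bound \<open>O(R ^ n)\<close>.\<close>

lemma Bp_norm_axis_fun_finite:
  fixes k :: "'n::finite"
  assumes p: "p > 0" and n: "CARD('n) \<ge> 2"
  shows "Bp_norm p (axis_fun p k) < \<infinity>"
proof -
  have "(\<integral>\<^sup>+x\<in>ball 0 R. ennreal (\<bar>axis_fun p k x\<bar> powr p) \<partial>lebesgue)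
      \<le> ennreal (2 ^ CARD('n) * R ^ CARD('n))" if R: "R \<ge> 1" for R
  proof -
    define B where "B = cbox (axis_vec k (- R) (- 1)) (axis_vec k R 1)"
    have "ennreal (\<bar>axis_fun p k x\<bar> powr p) * indicator (ball 0 R) x \<le> ennreal R * indicator B x"
      for x
    proof (cases "x \<in> axis_tube k \<inter> ball 0 R")
      case True
      then have "\<bar>x $ k\<bar> \<le> R"
        using component_le_norm_cart[of x k] by simp
      moreover from this have "x \<in> B"
        using True by (auto simp: B_def axis_tube_def axis_vec_def mem_box_cart abs_le_iff
            minus_le_iff)
      ultimately show ?thesis
        using True p by (simp add: axis_fun_powr ennreal_leI)
    next
      case False
      then show ?thesis
        using p by (auto simp: axis_fun_powr split: split_indicator)
    qed
    then have "(\<integral>\<^sup>+x\<in>ball 0 R. ennreal (\<bar>axis_fun p k x\<bar> powr p) \<partial>lebesgue)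
        \<le> (\<integral>\<^sup>+x. ennreal R * indicator B x \<partial>lebesgue)"
      by (rule nn_integral_mono)
    also have "\<dots> = ennreal R * emeasure lebesgue B"
      by (rule nn_integral_cmult_indicator) (simp add: B_def)
    also have "\<dots> = ennreal (2 ^ CARD('n) * R ^ 2)"
    proof -
      have "(2::real) ^ CARD('n) = 2 * 2 ^ (CARD('n) - 1)"
        using n by (cases "CARD('n)") auto
      then show ?thesis
        using R by (simp add: B_def emeasure_cbox_axis_vec power2_eq_square flip: ennreal_mult)
    qed
    also have "\<dots> \<le> ennreal (2 ^ CARD('n) * R ^ CARD('n))"
      using R n by (intro ennreal_leI mult_left_mono power_increasing) auto
    finally show ?thesis .
  qed
  then show ?thesis
    unfolding Bp_norm_finite_iff[OF p] by (intro exI[of _ "2 ^ CARD('n)"]) simp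
qed

text \<open>The boxes of half side length \<open>R\<close> along the axis and 1 across it see the whole quadratic
  growth of the integral, although the product of their half side lengths is only \<open>R\<close>.\<close>

lemma rect_Bp_norm_axis_fun_infinite:
  fixes k :: "'n::finite"
  assumes p: "p > 0"
  shows "\<not> rect_Bp_norm p (axis_fun p k) < \<infinity>"
proof
  assume "rect_Bp_norm p (axis_fun p k) < \<infinity>"
  then obtain C where C: "C \<ge> 0" "\<And>R. (\<forall>j. 1 \<le> R $ j) \<Longrightarrow>
      (\<integral>\<^sup>+x\<in>cbox (- R) R. ennreal (\<bar>axis_fun p k x\<bar> powr p) \<partial>lebesgue)
        \<le> ennreal (C * (\<Prod>j\<in>UNIV. R $ j))"
    unfolding rect_Bp_norm_finite_iff[OF assms] by blast
  \<comment> \<open>Large enough that \<open>R\<^sup>2 / 4 > C * R\<close>.\<close>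
  define R where "R = 4 * C + 1"
  have R: "R \<ge> 1"
    using C(1) by (simp add: R_def)
  \<comment> \<open>A part of the box of volume \<open>R / 2\<close> on which the integrand is at least \<open>R / 2\<close>.\<close>
  define B where "B = cbox (axis_vec k (R / 2) 0) (axis_vec k R 1)"
  define r where "r = axis_vec k R 1"
  have "ennreal (R / 2) * indicator B x
      \<le> ennreal (\<bar>axis_fun p k x\<bar> powr p) * indicator (cbox (- r) r) x" for x
  proof (cases "x \<in> B")
    case True
    then have k: "R / 2 \<le> x $ k" "x $ k \<le> R" and j: "\<And>j. j \<noteq> k \<Longrightarrow> 0 \<le> x $ j \<and> x $ j \<le> 1"
      by (auto simp: B_def axis_vec_def mem_box_cart split: if_splits)
    have "x \<in> axis_tube k"
      using j by (simp add: axis_tube_def)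
    moreover have "- r $ i \<le> x $ i \<and> x $ i \<le> r $ i" for i
      using k j[of i] R by (cases "i = k") (auto simp: r_def axis_vec_def)
    then have "x \<in> cbox (- r) r"
      by (simp add: mem_box_cart)
    ultimately show ?thesis
      using True k R p by (simp add: axis_fun_powr ennreal_leI)
  qed simp
  then have "(\<integral>\<^sup>+x. ennreal (R / 2) * indicator B x \<partial>lebesgue)
      \<le> (\<integral>\<^sup>+x\<in>cbox (- r) r. ennreal (\<bar>axis_fun p k x\<bar> powr p) \<partial>lebesgue)"
    by (rule nn_integral_mono)
  also have "\<dots> \<le> ennreal (C * R)"
    using C(2)[of r] R unfolding r_def prod_axis_vec by (simp add: axis_vec_def)
  finally have "ennreal (R / 2) * emeasure lebesgue B \<le> ennreal (C * R)"
    by (subst (asm) nn_integral_cmult_indicator) (simp_all add: B_def)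
  then have "ennreal (R / 2 * (R / 2)) \<le> ennreal (C * R)"
    using R by (simp add: B_def emeasure_cbox_axis_vec flip: ennreal_mult)
  then have "R / 2 * (R / 2) \<le> C * R"
    using R C(1) by (simp add: ennreal_le_iff)
  then have "R \<le> 4 * C"
    using R by (simp add: field_simps)
  then show False
    by (simp add: R_def)
qed

section \<open>Proper containment\<close>

theorem proposition1:
  fixes p :: real
  assumes "1 \<le> p" and "CARD('n::finite) \<ge> 2"
  shows "(rect_Bp_space p :: (real^'n \<Rightarrow> real) set set) \<subset> Bp_space p"
proof
  have p: "p > 0"
    using assms(1) by simp
  show "(rect_Bp_space p :: (real^'n \<Rightarrow> real) set set) \<subseteq> Bp_space p"
    by (rule rect_Bp_space_subset_Bp_space[OF p])
  define f where "f = axis_fun p (undefined :: 'n)"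
  have f: "f \<in> borel_measurable lebesgue" "Bp_norm p f < \<infinity>" "\<not> rect_Bp_norm p f < \<infinity>"
    unfolding f_def using p assms(2)
    by (simp_all only: borel_measurable_axis_fun Bp_norm_axis_fun_finite
        rect_Bp_norm_axis_fun_infinite not_False_eq_True)
  have "ae_eq `` {f} \<in> Bp_space p"
    unfolding Bp_space_def using f by (intro quotientI) simp
  moreover have "ae_eq `` {f} \<notin> rect_Bp_space p"
  proof
    assume "ae_eq `` {f} \<in> rect_Bp_space p"
    then obtain g where g: "g \<in> Lp_loc p" "rect_Bp_norm p g < \<infinity>" "ae_eq `` {f} = ae_eq `` {g}"
      unfolding rect_Bp_space_def by (auto elim!: quotientE)
    have "g \<in> borel_measurable lebesgue"
      using g(1) by (simp add: Lp_loc_def)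
    then have "(f, g) \<in> ae_eq"
      using eq_equiv_class[OF g(3) equiv_ae_eq] by blast
    then have "rect_Bp_norm p f = rect_Bp_norm p g"
      by (intro rect_Bp_norm_cong_AE) (simp add: ae_eq_def)
    with f(3) g(2) show False
      by simp
  qed
  ultimately show "(rect_Bp_space p :: (real^'n \<Rightarrow> real) set set) \<noteq> Bp_space p"
    by blast
qed

end
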